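(* There exist quasi-modular pseudometric spaces that are forward complete but not backward complete, and there exist quasi-modular pseudometric spaces that are backward complete but not forward complete.
   Context: A quasi-modular pseudometric on a nonempty set $X$ is a family $w=\{w_t\}_{t>0}$ of maps $w_t:X\times X\to[0,\infty]$, written $w(x,y,t):=w_t(x,y)$, such that: $w(x,x,t)=0$ for all $x\in X$, $t>0$; $w(x,z,t+s)\le w(x,y,t)+w(y,z,s)$ for all $x,y,z\in X$ and $s,t>0$; and $t\mapsto w(x,y,t)$ is right-continuous and nonincreasing for all $x,y$. The pair $(X,w)$ is a quasi-modular pseudometric space. A net $(x_i)_{i\in I}$ in $X$ is forward convergent to $x\in X$ if for every $r\in(0,1)$ and $t>0$ there is $i_0\in I$ with $w(x_i,x,t)<r$ for all $i\ge i_0$; it is backward convergent to $x$ if for every $r\in(0,1)$ and $t>0$ there is $i_0$ with $w(x,x_i,t)<r$ for all $i\ge i_0$. A net $(x_i)$ is forward Cauchy if for every $r\in(0,1)$ and $t>0$ there is $i_0$ with $w(x_i,x_j,t)<r$ for all $j\ge i\ge i_0$; it is backward Cauchy if for every $r\in(0,1)$ and $t>0$ there is $i_0$ with $w(x_j,x_i,t)<r$ for all $j\ge i\ge i_0$. $(X,w)$ is forward complete if every forward Cauchy net is forward convergent (to some point of $X$), and backward complete if every backward Cauchy net is backward convergent (to some point of $X$). *)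

theory Defs
  imports "HOL-Library.Extended_Nonnegative_Real" "HOL-Library.FuncSet"
begin

locale quasi_modular_pseudometric_space =
  fixes X :: "'a set" and w :: "'a \<Rightarrow> 'a \<Rightarrow> real \<Rightarrow> ennreal"
  assumes nonempty: "X \<noteq> {}"
    and refl: "\<lbrakk>x \<in> X; 0 < t\<rbrakk> \<Longrightarrow> w x x t = 0"
    and triangle: "\<lbrakk>x \<in> X; y \<in> X; z \<in> X; 0 < s; 0 < t\<rbrakk> \<Longrightarrow> w x z (t + s) \<le> w x y t + w y z s"
    and right_continuous: "\<lbrakk>x \<in> X; y \<in> X; 0 < t\<rbrakk> \<Longrightarrow> continuous (at_right t) (w x y)"
    and nonincreasing: "\<lbrakk>x \<in> X; y \<in> X; 0 < s; s \<le> t\<rbrakk> \<Longrightarrow> w x y t \<le> w x y s"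

text \<open>A pair \<open>(i, j) \<in> le\<close> means that \<open>i\<close> precedes \<open>j\<close>; antisymmetry is not required.\<close>

definition directed_set :: "'i set \<Rightarrow> 'i rel \<Rightarrow> bool" where
  "directed_set I le \<longleftrightarrow>
     I \<noteq> {} \<and> preorder_on I le \<and> (\<forall>i\<in>I. \<forall>j\<in>I. \<exists>k\<in>I. (i, k) \<in> le \<and> (j, k) \<in> le)"

definition net_in :: "'a set \<Rightarrow> 'i set \<Rightarrow> 'i rel \<Rightarrow> ('i \<Rightarrow> 'a) \<Rightarrow> bool" where
  "net_in X I le \<xi> \<longleftrightarrow> directed_set I le \<and> \<xi> \<in> I \<rightarrow> X"

definition forward_convergent ::
  "('a \<Rightarrow> 'a \<Rightarrow> real \<Rightarrow> ennreal) \<Rightarrow> 'i set \<Rightarrow> 'i rel \<Rightarrow> ('i \<Rightarrow> 'a) \<Rightarrow> 'a \<Rightarrow> bool" where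
  "forward_convergent w I le \<xi> x \<longleftrightarrow>
     (\<forall>r t. 0 < r \<and> r < 1 \<and> 0 < t \<longrightarrow>
        (\<exists>i0\<in>I. \<forall>i\<in>I. (i0, i) \<in> le \<longrightarrow> w (\<xi> i) x t < ennreal r))"

definition backward_convergent ::
  "('a \<Rightarrow> 'a \<Rightarrow> real \<Rightarrow> ennreal) \<Rightarrow> 'i set \<Rightarrow> 'i rel \<Rightarrow> ('i \<Rightarrow> 'a) \<Rightarrow> 'a \<Rightarrow> bool" where
  "backward_convergent w I le \<xi> x \<longleftrightarrow>
     (\<forall>r t. 0 < r \<and> r < 1 \<and> 0 < t \<longrightarrow>
        (\<exists>i0\<in>I. \<forall>i\<in>I. (i0, i) \<in> le \<longrightarrow> w x (\<xi> i) t < ennreal r))"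

definition forward_Cauchy ::
  "('a \<Rightarrow> 'a \<Rightarrow> real \<Rightarrow> ennreal) \<Rightarrow> 'i set \<Rightarrow> 'i rel \<Rightarrow> ('i \<Rightarrow> 'a) \<Rightarrow> bool" where
  "forward_Cauchy w I le \<xi> \<longleftrightarrow>
     (\<forall>r t. 0 < r \<and> r < 1 \<and> 0 < t \<longrightarrow>
        (\<exists>i0\<in>I. \<forall>i\<in>I. \<forall>j\<in>I. (i0, i) \<in> le \<and> (i, j) \<in> le \<longrightarrow> w (\<xi> i) (\<xi> j) t < ennreal r))"

definition backward_Cauchy ::
  "('a \<Rightarrow> 'a \<Rightarrow> real \<Rightarrow> ennreal) \<Rightarrow> 'i set \<Rightarrow> 'i rel \<Rightarrow> ('i \<Rightarrow> 'a) \<Rightarrow> bool" where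
  "backward_Cauchy w I le \<xi> \<longleftrightarrow>
     (\<forall>r t. 0 < r \<and> r < 1 \<and> 0 < t \<longrightarrow>
        (\<exists>i0\<in>I. \<forall>i\<in>I. \<forall>j\<in>I. (i0, i) \<in> le \<and> (i, j) \<in> le \<longrightarrow> w (\<xi> j) (\<xi> i) t < ennreal r))"

text \<open>
  A definition cannot quantify over the type of the index sets, so completeness refers to nets
  whose index set consists of elements of \<^typ>\<open>'a \<times> nat\<close>. This is no restriction: by
  \<open>forward_complete_any_index\<close> and \<open>backward_complete_any_index\<close> below, it implies convergence of
  the Cauchy nets over directed sets of every type.
\<close>

definition forward_complete :: "'a set \<Rightarrow> ('a \<Rightarrow> 'a \<Rightarrow> real \<Rightarrow> ennreal) \<Rightarrow> bool" where
  "forward_complete X w \<longleftrightarrow>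
     (\<forall>(I :: ('a \<times> nat) set) le \<xi>. net_in X I le \<xi> \<and> forward_Cauchy w I le \<xi> \<longrightarrow>
        (\<exists>x\<in>X. forward_convergent w I le \<xi> x))"

definition backward_complete :: "'a set \<Rightarrow> ('a \<Rightarrow> 'a \<Rightarrow> real \<Rightarrow> ennreal) \<Rightarrow> bool" where
  "backward_complete X w \<longleftrightarrow>
     (\<forall>(I :: ('a \<times> nat) set) le \<xi>. net_in X I le \<xi> \<and> backward_Cauchy w I le \<xi> \<longrightarrow>
        (\<exists>x\<in>X. backward_convergent w I le \<xi> x))"

lemma small_closed_subset:
  fixes c :: "nat \<Rightarrow> 'i" and b :: "'a \<Rightarrow> 'i \<Rightarrow> 'i" and u :: "'i \<Rightarrow> 'i \<Rightarrow> 'i"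
  assumes "\<And>n. c n \<in> I"
    and "\<And>x i. \<lbrakk>x \<in> X; i \<in> I\<rbrakk> \<Longrightarrow> b x i \<in> I"
    and "\<And>i j. \<lbrakk>i \<in> I; j \<in> I\<rbrakk> \<Longrightarrow> u i j \<in> I"
  obtains J and g :: "'i \<Rightarrow> 'a \<times> nat" where "J \<subseteq> I" "inj_on g J" "\<And>n. c n \<in> J"
    "\<And>x i. \<lbrakk>x \<in> X; i \<in> J\<rbrakk> \<Longrightarrow> b x i \<in> J"
    "\<And>i j. \<lbrakk>i \<in> J; j \<in> J\<rbrakk> \<Longrightarrow> u i j \<in> J"
proof -
  let ?U = "UNIV :: ('a \<times> nat) set"
  define step where "step A = A \<union> range c \<union> (\<lambda>(x, i). b x i) ` (X \<times> A) \<union> (\<lambda>(i, j). u i j) ` (A \<times> A)" for A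
  define K where "K n = (step ^^ n) {}" for n
  have K_0: "K 0 = {}" and K_Suc: "\<And>n. K (Suc n) = step (K n)"
    by (simp_all add: K_def)
  define J where "J = (\<Union>n. K n)"
  have infU: "infinite ?U"
    by (simp add: finite_prod)
  have times: "(card_of (A \<times> B), card_of ?U) \<in> ordLeq"
    if "(card_of A, card_of ?U) \<in> ordLeq" "(card_of B, card_of ?U) \<in> ordLeq"
    for A :: "'x set" and B :: "'y set"
    by (rule card_of_Times_ordLeq_infinite_Field) (use that infU card_of_Card_order in \<open>auto simp: Field_card_of\<close>)
  have un: "(card_of (A \<union> B), card_of ?U) \<in> ordLeq"
    if "(card_of A, card_of ?U) \<in> ordLeq" "(card_of B, card_of ?U) \<in> ordLeq" for A B :: "'i set"
    by (rule card_of_Un_ordLeq_infinite_Field) (use that infU card_of_Card_order in \<open>auto simp: Field_card_of\<close>)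
  have img: "(card_of (f ` A), card_of ?U) \<in> ordLeq"
    if "(card_of A, card_of ?U) \<in> ordLeq" for f :: "'x \<Rightarrow> 'i" and A
    using card_of_image ordLeq_transitive that by blast
  have natU: "(card_of (UNIV :: nat set), card_of ?U) \<in> ordLeq"
    using infU infinite_iff_card_of_nat by blast
  have XU: "(card_of X, card_of ?U) \<in> ordLeq"
    by (rule card_of_ordLeqI[where f = "\<lambda>x. (x, 0)"]) (auto simp: inj_on_def)
  have KU: "(card_of (K n), card_of ?U) \<in> ordLeq" for n
  proof (induction n)
    case 0
    then show ?case by (simp add: K_0 card_of_empty)
  next
    case (Suc n)
    then show ?case
      unfolding K_Suc step_def by (intro un img times natU XU)
  qed
  have "(card_of J, card_of ?U) \<in> ordLeq"
    unfolding J_def by (rule card_of_UNION_ordLeq_infinite) (use infU natU KU in auto)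
  then obtain g :: "'i \<Rightarrow> 'a \<times> nat" where g: "inj_on g J"
    using card_of_ordLeq[of J ?U] by blast
  have "mono K"
    by (rule monoI, rule lift_Suc_mono_le) (auto simp: K_Suc step_def)
  have "K n \<subseteq> I" for n
  proof (induction n)
    case 0
    then show ?case by (simp add: K_0)
  next
    case (Suc n)
    then have "\<And>i. i \<in> K n \<Longrightarrow> i \<in> I" by blast
    then show ?case
      unfolding K_Suc step_def using Suc assms(1) by (auto intro!: assms(2,3))
  qed
  then have JI: "J \<subseteq> I" by (auto simp: J_def)
  have cJ: "c n \<in> J" for n
    unfolding J_def using K_Suc[of 0] by (auto simp: step_def intro!: exI[of _ "Suc 0"])
  have bJ: "b x i \<in> J" if "x \<in> X" "i \<in> J" for x i
  proof -
    from that(2) obtain n where "i \<in> K n" by (auto simp: J_def)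
    then have "b x i \<in> K (Suc n)" using that(1) by (force simp: K_Suc step_def)
    then show ?thesis by (auto simp: J_def)
  qed
  have uJ: "u i j \<in> J" if ij: "i \<in> J" "j \<in> J" for i j
  proof -
    from ij obtain m n where "i \<in> K m" "j \<in> K n" by (auto simp: J_def)
    then have "i \<in> K (max m n)" "j \<in> K (max m n)"
      using monoD[OF \<open>mono K\<close>, of m "max m n"] monoD[OF \<open>mono K\<close>, of n "max m n"] by auto
    then have "u i j \<in> K (Suc (max m n))" by (force simp: K_Suc step_def)
    then show ?thesis by (auto simp: J_def)
  qed
  show ?thesis by (rule that[OF JI g cJ bJ uJ])
qed

lemma forward_complete_any_index:
  fixes X :: "'a set" and I :: "'i set"
  assumes "quasi_modular_pseudometric_space X w" and complete: "forward_complete X w"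
    and net: "net_in X I le \<xi>" and Cauchy: "forward_Cauchy w I le \<xi>"
  shows "\<exists>x\<in>X. forward_convergent w I le \<xi> x"
proof (rule ccontr)
  assume nonconv: "\<not> ?thesis"
  interpret quasi_modular_pseudometric_space X w by fact
  let ?e = "\<lambda>n::nat. 1 / (real n + 2)"
  have I: "I \<noteq> {}" "refl_on I le" "trans le" and le: "le \<subseteq> I \<times> I"
    and ub: "\<And>i j. \<lbrakk>i \<in> I; j \<in> I\<rbrakk> \<Longrightarrow> \<exists>k\<in>I. (i, k) \<in> le \<and> (j, k) \<in> le"
    and \<xi>: "\<And>i. i \<in> I \<Longrightarrow> \<xi> i \<in> X"
    using net by (auto simp: net_in_def directed_set_def preorder_on_def)
  have "\<exists>i0. i0 \<in> I \<and> (\<forall>i\<in>I. \<forall>j\<in>I. (i0, i) \<in> le \<and> (i, j) \<in> le \<longrightarrow>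
          w (\<xi> i) (\<xi> j) (?e n) < ennreal (?e n))" for n
    using Cauchy[unfolded forward_Cauchy_def, rule_format, of "?e n" "?e n"] by auto
  then obtain c where c: "\<And>n. c n \<in> I"
    and cC: "\<And>n i j. \<lbrakk>i \<in> I; j \<in> I; (c n, i) \<in> le; (i, j) \<in> le\<rbrakk> \<Longrightarrow>
          w (\<xi> i) (\<xi> j) (?e n) < ennreal (?e n)"
    by metis
  have "\<exists>r t. 0 < r \<and> r < 1 \<and> 0 < t \<and>
      (\<forall>i0\<in>I. \<exists>i\<in>I. (i0, i) \<in> le \<and> \<not> w (\<xi> i) x t < ennreal r)" if "x \<in> X" for x
    using nonconv that unfolding forward_convergent_def by blast
  then obtain R T where RT: "\<And>x. x \<in> X \<Longrightarrow> 0 < R x \<and> R x < 1 \<and> 0 < T x \<and>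
      (\<forall>i0\<in>I. \<exists>i\<in>I. (i0, i) \<in> le \<and> \<not> w (\<xi> i) x (T x) < ennreal (R x))"
    by metis
  then obtain b where b: "\<And>x i. \<lbrakk>x \<in> X; i \<in> I\<rbrakk> \<Longrightarrow>
      b x i \<in> I \<and> (i, b x i) \<in> le \<and> \<not> w (\<xi> (b x i)) x (T x) < ennreal (R x)"
    by metis
  obtain u where u: "\<And>i j. \<lbrakk>i \<in> I; j \<in> I\<rbrakk> \<Longrightarrow> u i j \<in> I \<and> (i, u i j) \<in> le \<and> (j, u i j) \<in> le"
    using ub by metis
  obtain J and g :: "'i \<Rightarrow> 'a \<times> nat" where J: "J \<subseteq> I" "inj_on g J" and cJ: "\<And>n. c n \<in> J"
    and bJ: "\<And>x i. \<lbrakk>x \<in> X; i \<in> J\<rbrakk> \<Longrightarrow> b x i \<in> J"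
    and uJ: "\<And>i j. \<lbrakk>i \<in> J; j \<in> J\<rbrakk> \<Longrightarrow> u i j \<in> J"
    by (rule small_closed_subset[of c I X b u]) (use c b u in blast)+
  define h where "h = inv_into J g"
  define L where "L = g ` J"
  define le' where "le' = {(p, q). p \<in> L \<and> q \<in> L \<and> (h p, h q) \<in> le}"
  have hg: "h (g i) = i" if "i \<in> J" for i
    using that J by (simp add: h_def)
  have hJ: "h p \<in> J" if "p \<in> L" for p
    using that hg by (auto simp: L_def)
  have gL: "g i \<in> L" if "i \<in> J" for i
    using that by (simp add: L_def)
  have "directed_set L le'"
    unfolding directed_set_def preorder_on_def
  proof (intro conjI ballI)
    show "L \<noteq> {}" using cJ by (auto simp: L_def)
    show "le' \<subseteq> L \<times> L" by (auto simp: le'_def)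
    show "refl_on L le'" using I(2) hJ J by (auto simp: refl_on_def le'_def)
    show "trans le'" using I(3) unfolding trans_def le'_def by blast
    fix p q assume "p \<in> L" "q \<in> L"
    with uJ hJ gL hg u J have "g (u (h p) (h q)) \<in> L \<and> (p, g (u (h p) (h q))) \<in> le' \<and>
        (q, g (u (h p) (h q))) \<in> le'"
      unfolding le'_def by (auto simp: subset_iff)
    then show "\<exists>k\<in>L. (p, k) \<in> le' \<and> (q, k) \<in> le'" by blast
  qed
  then have "net_in X L le' (\<xi> \<circ> h)"
    using hJ J(1) \<xi> by (auto simp: net_in_def Pi_iff subset_iff simp del: split_paired_All)
  moreover have "forward_Cauchy w L le' (\<xi> \<circ> h)"
    unfolding forward_Cauchy_def
  proof (intro allI impI)
    fix r t :: real assume rt: "0 < r \<and> r < 1 \<and> 0 < t"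
    obtain n where "1 / min r t < real n" using reals_Archimedean2 by blast
    then have "1 < min r t * real n" using rt by (simp add: field_simps)
    also have "\<dots> \<le> min r t * (real n + 2)" using rt by (intro mult_left_mono) auto
    finally have n: "?e n < min r t"
      by (simp add: divide_less_eq mult.commute del: min_less_iff_conj)
    show "\<exists>i0\<in>L. \<forall>i\<in>L. \<forall>j\<in>L. (i0, i) \<in> le' \<and> (i, j) \<in> le' \<longrightarrow>
        w ((\<xi> \<circ> h) i) ((\<xi> \<circ> h) j) t < ennreal r"
    proof (intro bexI[of _ "g (c n)"] ballI impI)
      show "g (c n) \<in> L" using cJ gL by blast
      fix p q assume pq: "p \<in> L" "q \<in> L" "(g (c n), p) \<in> le' \<and> (p, q) \<in> le'"
      have m: "h p \<in> I" "h q \<in> I" using pq hJ J(1) by blast+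
      have "w (\<xi> (h p)) (\<xi> (h q)) t \<le> w (\<xi> (h p)) (\<xi> (h q)) (?e n)"
        using m \<xi> n by (intro nonincreasing) auto
      also have "\<dots> < ennreal (?e n)"
        using m pq hg cJ by (intro cC) (auto simp: le'_def)
      also have "\<dots> \<le> ennreal r" using n by (intro ennreal_leI) auto
      finally show "w ((\<xi> \<circ> h) p) ((\<xi> \<circ> h) q) t < ennreal r" by simp
    qed
  qed
  ultimately obtain x where x: "x \<in> X" "forward_convergent w L le' (\<xi> \<circ> h) x"
    using complete unfolding forward_complete_def by blast
  then obtain p where p: "p \<in> L" "\<And>q. \<lbrakk>q \<in> L; (p, q) \<in> le'\<rbrakk> \<Longrightarrow> w (\<xi> (h q)) x (T x) < ennreal (R x)"
    using RT[OF x(1)] unfolding forward_convergent_def comp_def by blast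
  have hp: "h p \<in> J" "h p \<in> I" using p(1) hJ J(1) by blast+
  have "w (\<xi> (h (g (b x (h p))))) x (T x) < ennreal (R x)"
    using b[OF x(1) hp(2)] bJ[OF x(1) hp(1)] gL hg p(1) by (intro p(2)) (auto simp: le'_def)
  then show False
    using b[OF x(1) hp(2)] bJ[OF x(1) hp(1)] hg by simp
qed

lemma backward_complete_any_index:
  fixes X :: "'a set" and I :: "'i set"
  assumes "quasi_modular_pseudometric_space X w" and complete: "backward_complete X w"
    and "net_in X I le \<xi>" and "backward_Cauchy w I le \<xi>"
  shows "\<exists>x\<in>X. backward_convergent w I le \<xi> x"
proof -
  interpret quasi_modular_pseudometric_space X w by fact
  let ?v = "\<lambda>x y. w y x"
  have v: "quasi_modular_pseudometric_space X ?v"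
  proof
    fix x y z and s t :: real
    assume *: "x \<in> X" "y \<in> X" "z \<in> X" "0 < s" "0 < t"
    then show "w z x (t + s) \<le> w y x t + w z y s"
      using triangle[of z y x t s] by (simp add: add.commute)
  qed (use nonempty refl right_continuous nonincreasing in auto)
  have "forward_complete X ?v"
    using complete unfolding forward_complete_def backward_complete_def forward_convergent_def
      backward_convergent_def forward_Cauchy_def backward_Cauchy_def .
  from forward_complete_any_index[OF v this assms(3)] assms(4) show ?thesis
    unfolding forward_convergent_def backward_convergent_def forward_Cauchy_def backward_Cauchy_def .
qed

end

(* On the naturals put w x y t = 0 if x >= y and 1 otherwise. The point 0 is a forward limit of every
   net, whereas the sequence 0, 1, 2, ... is backward Cauchy without a backward limit, since w x n t = 1
   for n > x. Exchanging the arguments of w gives the second example. *)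
theory Submission
  imports Defs
begin

text \<open>Reversal traverses the two legs in the opposite order, so the triangle inequality is
  used with \<open>s\<close> and \<open>t\<close> exchanged.\<close>

lemma quasi_modular_pseudometric_space_swap:
  assumes "quasi_modular_pseudometric_space X w"
  shows "quasi_modular_pseudometric_space X (\<lambda>x y. w y x)"
proof -
  interpret quasi_modular_pseudometric_space X w by fact
  show ?thesis
  proof
    fix x y z and s t :: real
    assume "x \<in> X" "y \<in> X" "z \<in> X" "0 < s" "0 < t"
    then show "w z x (t + s) \<le> w y x t + w z y s"
      using triangle[of z y x t s] by (simp add: add.commute)
  qed (use nonempty refl right_continuous nonincreasing in auto)
qed

text \<open>Each forward notion for the swapped function unfolds literally to the backward notion
  for \<open>w\<close>.\<close>

lemma forward_complete_swap: "forward_complete X (\<lambda>x y. w y x) \<longleftrightarrow> backward_complete X w"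
  unfolding forward_complete_def backward_complete_def forward_convergent_def
    backward_convergent_def forward_Cauchy_def backward_Cauchy_def ..

lemma backward_complete_swap: "backward_complete X (\<lambda>x y. w y x) \<longleftrightarrow> forward_complete X w"
  using forward_complete_swap[of X "\<lambda>x y. w y x"] by simp

text \<open>Only the values 0 and 1 occur, so for a radius \<open>r\<close> in (0,1) being less than
  \<open>r\<close> just means \<open>y \<le> x\<close>.\<close>

definition order_modular :: "'a::linorder \<Rightarrow> 'a \<Rightarrow> real \<Rightarrow> ennreal" where
  "order_modular x y t = of_bool (x < y)"

text \<open>By linearity \<open>x < z\<close> forces \<open>x < y\<close> or \<open>y < z\<close>,
  which is the triangle inequality; the conditions on \<open>t\<close> hold because the function is
  constant in \<open>t\<close>.\<close>

lemma quasi_modular_pseudometric_space_order_modular: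
  "X \<noteq> {} \<Longrightarrow> quasi_modular_pseudometric_space X order_modular"
  by unfold_locales (auto simp: order_modular_def[abs_def])

text \<open>No term of a net lies below the least element \<open>b\<close>, so all distances to
  \<open>b\<close> vanish and any index serves as \<open>i0\<close>.\<close>

lemma forward_complete_order_modular:
  assumes "b \<in> X" and "\<And>x. x \<in> X \<Longrightarrow> b \<le> x"
  shows "forward_complete X order_modular"
  unfolding forward_complete_def
proof (intro allI impI bexI)
  fix I :: "('a \<times> nat) set" and le \<xi>
  assume "net_in X I le \<xi> \<and> forward_Cauchy order_modular I le \<xi>"
  then have "I \<noteq> {}" and "\<And>i. i \<in> I \<Longrightarrow> \<not> \<xi> i < b"
    using assms(2) by (auto simp: net_in_def directed_set_def not_less simp del: split_paired_All)
  then show "forward_convergent order_modular I le \<xi> b"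
    by (auto simp: forward_convergent_def order_modular_def)
qed (rule assms(1))

lemma not_backward_complete_order_modular:
  "\<not> backward_complete (UNIV :: nat set) order_modular"
proof
  assume complete: "backward_complete (UNIV :: nat set) order_modular"
  \<comment> \<open>Completeness over \<open>nat\<close> speaks of index sets in
    \<open>nat \<times> nat\<close>, so the sequence 0, 1, 2, ... is indexed by pairs compared in
    the first component only.\<close>
  define I :: "(nat \<times> nat) set" where "I = UNIV"
  define le where "le = {(p :: nat \<times> nat, q :: nat \<times> nat). fst p \<le> fst q}"
  have "directed_set I le"
    unfolding directed_set_def preorder_on_def
  proof (intro conjI ballI)
    fix i j
    show "\<exists>k\<in>I. (i, k) \<in> le \<and> (j, k) \<in> le"
      by (rule bexI[of _ "(max (fst i) (fst j), 0)"]) (auto simp: le_def I_def)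
  qed (auto simp: I_def le_def refl_on_def trans_def)
  then have "net_in UNIV I le fst"
    by (simp add: net_in_def)
  moreover have "backward_Cauchy order_modular I le fst"
    by (auto simp: backward_Cauchy_def order_modular_def le_def I_def)
  ultimately obtain x where "backward_convergent order_modular I le fst x"
    using complete unfolding backward_complete_def by blast
  \<comment> \<open>A radius below 1 excludes the value 1.\<close>
  from this[unfolded backward_convergent_def, rule_format, of "1/2" 1]
  have "\<exists>p. \<forall>q. (p, q) \<in> le \<longrightarrow> order_modular x (fst q) 1 < ennreal (1/2)"
    by (simp add: I_def)
  then obtain p where p: "\<And>q. (p, q) \<in> le \<Longrightarrow> order_modular x (fst q) 1 < ennreal (1/2)"
    by blast
  \<comment> \<open>The maximum yields an index after \<open>p\<close> whose term strictly exceeds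
    \<open>x\<close>.\<close>
  have "order_modular x (max (fst p) (Suc x)) 1 < ennreal (1/2)"
    using p[of "(max (fst p) (Suc x), 0)"] by (simp add: le_def)
  moreover have "order_modular x (max (fst p) (Suc x)) 1 = ennreal 1"
    by (simp add: order_modular_def less_max_iff_disj)
  ultimately have "ennreal 1 < ennreal (1/2)"
    by (simp only:)
  then show False
    by (subst (asm) ennreal_less_iff) auto
qed

theorem theorem5p4:
  shows "(\<exists>(X :: nat set) w. quasi_modular_pseudometric_space X w \<and>
            forward_complete X w \<and> \<not> backward_complete X w) \<and>
         (\<exists>(X :: nat set) w. quasi_modular_pseudometric_space X w \<and>
            backward_complete X w \<and> \<not> forward_complete X w)"
proof -
  have space: "quasi_modular_pseudometric_space (UNIV :: nat set) order_modular"
    by (simp add: quasi_modular_pseudometric_space_order_modular)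
  have complete: "forward_complete (UNIV :: nat set) order_modular"
    by (rule forward_complete_order_modular[of 0]) auto
  show ?thesis
    using space quasi_modular_pseudometric_space_swap[OF space] complete
      not_backward_complete_order_modular
    by (metis forward_complete_swap backward_complete_swap)
qed

end
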